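(* Let $\Gamma$ be an abelian group, let $(G=(V,E),\psi)$ be a finite $\Gamma$-gain graph, and let $\mu$ be a symmetric polymatroidal function over $\Gamma$. If $\mu(\{\gamma\})\le1$ for every $\gamma\in\Gamma$, then the function $$\ell_\mu(F)=|V(F)|-c(F)+\mu(\langle\langle F\rangle\rangle)\qquad(F\subseteq E)$$ is monotone and submodular on $E$.
   Context: A $\Gamma$-gain graph: $G$ finite directed graph (loops, parallel edges allowed), $\psi:E\to\Gamma$, reversing an edge inverts its gain; the gain of a walk is the ordered product of edge gains with inverses for backward edges. For $F\subseteq E$: $V(F)$ = endvertices of $F$; $c(F)$ = number of connected components of $(V(F),F)$; $\langle\langle F\rangle\rangle$ = subgroup of $\Gamma$ generated by the gains of all closed walks (at any base vertex) using only edges of $F$. $\mu:2^\Gamma\to\mathbb{R}_{\ge0}$ is a symmetric polymatroidal function if $\mu(\emptyset)=0$, $\mu$ is monotone and submodular on subsets of $\Gamma$, $\mu(X)=\mu(\langle X\rangle)$ for nonempty $X$ (with $\langle X\rangle$ the generated subgroup), and $\mu(X)=\mu(\gamma X\gamma^{-1})$ for nonempty $X$ and $\gamma\in\Gamma$. *)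

theory Defs
  imports
    Complex_Main
    "HOL-Algebra.Generated_Groups"
    "Graph_Theory.Digraph"
    "Graph_Theory.Digraph_Component"
    "Graph_Theory.Arc_Walk"
begin

definition submodular_on :: "'a set \<Rightarrow> ('a set \<Rightarrow> real) \<Rightarrow> bool" where
  "submodular_on E f \<longleftrightarrow>
     (\<forall>X Y. X \<subseteq> E \<longrightarrow> Y \<subseteq> E \<longrightarrow> f (X \<union> Y) + f (X \<inter> Y) \<le> f X + f Y)"

text \<open>Only the values of \<open>\<mu>\<close> on subsets of the carrier matter. For nonempty \<open>X\<close>,
  \<open>generate \<Gamma> X\<close> is the subgroup generated by \<open>X\<close>. The value \<open>\<mu> {\<one>}\<close> is not
  required to be \<open>0\<close>.\<close>

definition symmetric_polymatroidal :: "('g, 'm) monoid_scheme \<Rightarrow> ('g set \<Rightarrow> real) \<Rightarrow> bool" where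
  "symmetric_polymatroidal \<Gamma> \<mu> \<longleftrightarrow>
     (\<forall>X \<subseteq> carrier \<Gamma>. 0 \<le> \<mu> X) \<and>
     \<mu> {} = 0 \<and>
     mono_on (Pow (carrier \<Gamma>)) \<mu> \<and>
     submodular_on (carrier \<Gamma>) \<mu> \<and>
     (\<forall>X \<subseteq> carrier \<Gamma>. X \<noteq> {} \<longrightarrow> \<mu> X = \<mu> (generate \<Gamma> X)) \<and>
     (\<forall>X \<subseteq> carrier \<Gamma>. X \<noteq> {} \<longrightarrow>
        (\<forall>\<gamma> \<in> carrier \<Gamma>. \<mu> X = \<mu> ((\<lambda>x. \<gamma> \<otimes>\<^bsub>\<Gamma>\<^esub> x \<otimes>\<^bsub>\<Gamma>\<^esub> inv\<^bsub>\<Gamma>\<^esub> \<gamma>) ` X)))"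

locale gain_graph = group \<Gamma> + fin_digraph G
  for \<Gamma> :: "('g, 'm) monoid_scheme" and G :: "('v, 'e) pre_digraph" +
  fixes \<psi> :: "'e \<Rightarrow> 'g"
  assumes gain_closed: "e \<in> arcs G \<Longrightarrow> \<psi> e \<in> carrier \<Gamma>"

definition edge_verts :: "('v, 'e) pre_digraph \<Rightarrow> 'e set \<Rightarrow> 'v set" where
  "edge_verts G F = tail G ` F \<union> head G ` F"

definition edge_subgraph :: "('v, 'e) pre_digraph \<Rightarrow> 'e set \<Rightarrow> ('v, 'e) pre_digraph" where
  "edge_subgraph G F = \<lparr>verts = edge_verts G F, arcs = F, tail = tail G, head = head G\<rparr>"

text \<open>Components are the maximal connected subgraphs. \<^const>\<open>Digraph_Component.connected\<close>
  ignores orientations and requires a nonempty vertex set, so the graph without edges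
  counts zero components.\<close>

definition num_components :: "('v, 'e) pre_digraph \<Rightarrow> 'e set \<Rightarrow> nat" where
  "num_components G F =
     card {H. pre_digraph.max_subgraph (edge_subgraph G F) Digraph_Component.connected H}"

text \<open>Walks in a gain graph may traverse an edge against its orientation. They are
  directed walks in the digraph that has, for each edge \<open>e\<close>, the arc \<open>(e, True)\<close>
  oriented like \<open>e\<close> and the arc \<open>(e, False)\<close> oriented the opposite way.\<close>

definition both_directions :: "('v, 'e) pre_digraph \<Rightarrow> ('v, 'e \<times> bool) pre_digraph" where
  "both_directions G =
     \<lparr>verts = verts G,
      arcs = arcs G \<times> UNIV,
      tail = (\<lambda>(e, b). if b then tail G e else head G e),
      head = (\<lambda>(e, b). if b then head G e else tail G e)\<rparr>"

primrec walk_gain :: "('g, 'm) monoid_scheme \<Rightarrow> ('e \<Rightarrow> 'g) \<Rightarrow> ('e \<times> bool) list \<Rightarrow> 'g" where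
  "walk_gain \<Gamma> \<psi> [] = \<one>\<^bsub>\<Gamma>\<^esub>"
| "walk_gain \<Gamma> \<psi> (s # p) =
     (if snd s then \<psi> (fst s) else inv\<^bsub>\<Gamma>\<^esub> (\<psi> (fst s))) \<otimes>\<^bsub>\<Gamma>\<^esub> walk_gain \<Gamma> \<psi> p"

text \<open>The base vertex \<open>u\<close> of the closed walks is arbitrary. For \<open>F = {}\<close> the result is
  the trivial subgroup.\<close>

definition gain_subgroup ::
    "('g, 'm) monoid_scheme \<Rightarrow> ('v, 'e) pre_digraph \<Rightarrow> ('e \<Rightarrow> 'g) \<Rightarrow> 'e set \<Rightarrow> 'g set" where
  "gain_subgroup \<Gamma> G \<psi> F =
     generate \<Gamma> {walk_gain \<Gamma> \<psi> p | u p.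
       pre_digraph.awalk (both_directions (edge_subgraph G F)) u p u}"

definition ell ::
    "('g, 'm) monoid_scheme \<Rightarrow> ('v, 'e) pre_digraph \<Rightarrow> ('e \<Rightarrow> 'g) \<Rightarrow> ('g set \<Rightarrow> real)
      \<Rightarrow> 'e set \<Rightarrow> real" where
  "ell \<Gamma> G \<psi> \<mu> F =
     real (card (edge_verts G F)) - real (num_components G F) + \<mu> (gain_subgroup \<Gamma> G \<psi> F)"

end

theory Submission
  imports Defs
begin

text \<open>It suffices that the increment of \<open>\<ell>\<close> caused by adding an edge \<open>e\<close> is nonnegative and does
  not grow when the edge set grows from \<open>X\<close> to \<open>Y\<close>. If the ends of \<open>e\<close> are not connected, the rank
  \<open>|V(F)| - c(F)\<close> rises by 1 and the gain subgroup is unchanged. If they are connected by a walk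
  of gain \<open>h\<close>, the rank is unchanged and, \<open>\<Gamma>\<close> being abelian, the gain subgroup is enlarged
  by the single generator \<open>\<psi> e \<otimes> inv h\<close>; the increment is then at most 1 because
  \<open>\<mu> {\<gamma>} \<le> 1\<close>. When the ends are connected in \<open>X\<close>, the same \<open>h\<close> serves for \<open>Y\<close>, and
  submodularity of \<open>\<mu>\<close> compares the two increments.\<close>

section \<open>Set functions\<close>

text \<open>Elements are added one at a time, by induction on the finite set \<open>Z\<close> of new
  elements, and the inequalities between single increments add up.\<close>

lemma mono_submodular_by_increments:
  fixes f :: "'a set \<Rightarrow> real"
  assumes "finite E"
    and mono: "\<And>X e. X \<subseteq> E \<Longrightarrow> e \<in> E \<Longrightarrow> f X \<le> f (insert e X)"
    and dim: "\<And>X Y e. X \<subseteq> Y \<Longrightarrow> Y \<subseteq> E \<Longrightarrow> e \<in> E \<Longrightarrow>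
      f (insert e Y) - f Y \<le> f (insert e X) - f X"
  shows "mono_on (Pow E) f \<and> submodular_on E f"
proof
  have up: "f A \<le> f (A \<union> Z)" if "finite Z" "A \<subseteq> E" "Z \<subseteq> E" for A Z
    using that
  proof (induction Z)
    case (insert e Z)
    then show ?case
      using mono[of "A \<union> Z" e] by auto
  qed simp
  show "mono_on (Pow E) f"
  proof (rule mono_onI)
    fix A B assume "A \<in> Pow E" "B \<in> Pow E" "A \<subseteq> B"
    then show "f A \<le> f B"
      using up[of B A] assms(1) by (auto simp: Un_absorb1 finite_subset)
  qed
  have inc: "f (B \<union> Z) - f B \<le> f (A \<union> Z) - f A"
    if "finite Z" "A \<subseteq> B" "B \<subseteq> E" "Z \<subseteq> E" for A B Z
    using that
  proof (induction Z)
    case (insert e Z)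
    then show ?case
      using dim[of "A \<union> Z" "B \<union> Z" e] by fastforce
  qed simp
  show "submodular_on E f"
    unfolding submodular_on_def
  proof (intro allI impI)
    fix X Y assume "X \<subseteq> E" "Y \<subseteq> E"
    \<comment> \<open>Adding \<open>Y\<close> to \<open>X \<inter> Y\<close> yields
      \<open>Y\<close>, adding it to the larger set \<open>X\<close> yields
      \<open>X \<union> Y\<close>.\<close>
    then show "f (X \<union> Y) + f (X \<inter> Y) \<le> f X + f Y"
      using inc[of Y "X \<inter> Y" X] assms(1) by (simp add: finite_subset Un_absorb1)
  qed
qed

text \<open>If \<open>g\<close> lies in \<open>K\<close>, the left side is 0 and monotonicity
  suffices. Otherwise submodularity applies to \<open>insert g H\<close> and \<open>K\<close>, which
  meet exactly in \<open>H\<close>.\<close>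

lemma submodular_insert_diminishing:
  assumes "submodular_on C \<mu>" "mono_on (Pow C) \<mu>" "H \<subseteq> K" "K \<subseteq> C" "g \<in> C"
  shows "\<mu> (insert g K) - \<mu> K \<le> \<mu> (insert g H) - \<mu> H"
proof (cases "g \<in> K")
  case True
  then show ?thesis
    using mono_onD[OF assms(2), of H "insert g H"] assms(3-5) by (auto simp: insert_absorb)
next
  case False
  then have "insert g H \<union> K = insert g K" "insert g H \<inter> K = H"
    using assms(3) by auto
  then show ?thesis
    using assms unfolding submodular_on_def by (smt (verit) insert_subset subset_trans)
qed

lemma submodular_insert_le:
  assumes "submodular_on C \<mu>" "\<And>X. X \<subseteq> C \<Longrightarrow> 0 \<le> \<mu> X" "K \<subseteq> C" "g \<in> C"
  shows "\<mu> (insert g K) \<le> \<mu> K + \<mu> {g}"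
proof -
  have "\<mu> ({g} \<union> K) + \<mu> ({g} \<inter> K) \<le> \<mu> {g} + \<mu> K"
    using assms(1,3,4) unfolding submodular_on_def by blast
  moreover have "0 \<le> \<mu> ({g} \<inter> K)" using assms(2,3) by (simp add: le_infI2)
  ultimately show ?thesis by simp
qed

section \<open>Connected components\<close>

text \<open>Passing from \<open>r\<close> to \<open>r'\<close> replaces the two distinct classes of
  \<open>a\<close> and \<open>b\<close> by their union and keeps all others.\<close>

lemma card_quotient_merge:
  assumes "finite V" and r: "refl r" "sym r" "trans r"
    and ab: "a \<in> V" "b \<in> V" "(a, b) \<notin> r"
    and r': "r' = r \<union> r `` {a} \<times> r `` {b} \<union> r `` {b} \<times> r `` {a}"
  shows "card (V // r) = Suc (card (V // r'))"
proof -
  have eq: "r `` {x} = r `` {y} \<longleftrightarrow> (x, y) \<in> r" for x y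
    using r by (simp add: eq_equiv_class_iff[of UNIV] equiv_def)
  let ?A = "r `` {a}" and ?B = "r `` {b}"
  have merged: "r' `` {x} = (if x \<in> ?A \<union> ?B then ?A \<union> ?B else r `` {x})" for x
    using r unfolding r' by (auto dest: symD transD)
  have ne: "?A \<noteq> ?B" using ab(3) eq by blast
  have self: "x \<in> r `` {x}" for x using r(1) by (simp add: refl_on_def)
  have "V // r' = insert (?A \<union> ?B) (V // r - {?A, ?B})" (is "_ = insert _ ?R")
  proof (intro equalityI subsetI)
    fix S assume "S \<in> V // r'"
    then obtain x where x: "x \<in> V" "S = r' `` {x}" by (auto elim: quotientE)
    show "S \<in> insert (?A \<union> ?B) ?R"
    proof (cases "x \<in> ?A \<union> ?B")
      case False
      then have "r `` {x} \<noteq> ?A" "r `` {x} \<noteq> ?B" using self[of x] by auto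
      then show ?thesis using False x merged by (simp add: quotientI)
    qed (simp add: x merged)
  next
    fix S assume S: "S \<in> insert (?A \<union> ?B) ?R"
    show "S \<in> V // r'"
    proof (cases "S = ?A \<union> ?B")
      case True
      then have "S = r' `` {a}" using merged[of a] self[of a] by simp
      then show ?thesis using ab(1) by (simp add: quotientI)
    next
      case False
      then have "S \<in> V // r" and ne: "S \<noteq> ?A" "S \<noteq> ?B" using S by simp_all
      then obtain x where x: "x \<in> V" "S = r `` {x}" by (elim quotientE)
      then have "x \<notin> ?A \<union> ?B" using ne eq[of a x] eq[of b x] by simp
      then have "S = r' `` {x}" using x merged[of x] by simp
      then show ?thesis using x(1) by (simp add: quotientI)
    qed
  qed
  \<comment> \<open>The union is not among the old classes, since it contains the unrelated elements
    \<open>a\<close> and \<open>b\<close>; hence the insertion really adds one class.\<close>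
  moreover have "?A \<union> ?B \<notin> ?R"
  proof
    assume "?A \<union> ?B \<in> ?R"
    then have "?A \<union> ?B \<in> V // r" by simp
    then obtain x where x: "?A \<union> ?B = r `` {x}" by (elim quotientE)
    then have "(x, a) \<in> r" "(x, b) \<in> r" using self[of a] self[of b] by auto
    then show False using ab(3) r by (meson symD transD)
  qed
  moreover have fin: "finite (V // r)"
    using assms(1) by (simp add: quotient_def)
  moreover have "card (V // r) = Suc (Suc (card ?R))"
  proof -
    have "V // r = insert ?A (insert ?B ?R)"
      using ab by (auto intro: quotientI)
    also have "card \<dots> = Suc (Suc (card ?R))"
      using ne fin by simp
    finally show ?thesis .
  qed
  ultimately show ?thesis by simp
qed

section \<open>Connectivity by the edges of F as an equivalence relation\<close>

definition edge_rel :: "('v, 'e) pre_digraph \<Rightarrow> 'e set \<Rightarrow> 'v rel" where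
  "edge_rel G F = (\<Union>e\<in>F. {(tail G e, head G e), (head G e, tail G e)})"

text \<open>Reflexive on the whole vertex type, so that a vertex outside V(F) forms a class of its
  own and one fixed vertex set can serve for all F.\<close>

abbreviation conn :: "('v, 'e) pre_digraph \<Rightarrow> 'e set \<Rightarrow> 'v rel" where
  "conn G F \<equiv> (edge_rel G F)\<^sup>*"

lemma sym_conn: "sym (conn G F)"
  by (intro sym_rtrancl) (auto simp: sym_def edge_rel_def)

lemma conn_sym: "(u, v) \<in> conn G F \<Longrightarrow> (v, u) \<in> conn G F"
  using sym_conn by (rule symD)

lemma conn_mono: "X \<subseteq> Y \<Longrightarrow> conn G X \<subseteq> conn G Y"
  by (intro rtrancl_mono) (auto simp: edge_rel_def)

text \<open>The right side has the shape of \<open>r'\<close> in \<open>card_quotient_merge\<close>: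
  a new connection leads from the class of one end of \<open>e\<close> to the class of the
  other.\<close>

lemma conn_insert:
  "conn G (insert e F) = conn G F \<union> conn G F `` {tail G e} \<times> conn G F `` {head G e}
     \<union> conn G F `` {head G e} \<times> conn G F `` {tail G e}"
proof -
  have "edge_rel G (insert e F) =
      insert (tail G e, head G e) (insert (head G e, tail G e) (edge_rel G F))"
    by (auto simp: edge_rel_def)
  then have "conn G (insert e F) =
      (insert (tail G e, head G e) (insert (head G e, tail G e) (edge_rel G F)))\<^sup>*" by simp
  also have "\<dots> = conn G F \<union> conn G F `` {tail G e} \<times> conn G F `` {head G e}
     \<union> conn G F `` {head G e} \<times> conn G F `` {tail G e}"
    unfolding rtrancl_insert by (auto dest: conn_sym rtrancl_trans)
  finally show ?thesis .
qed

lemma conn_insert_connected: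
  assumes "(tail G e, head G e) \<in> conn G F"
  shows "conn G (insert e F) = conn G F"
proof -
  have "(x, y) \<in> conn G F" if "(tail G e, x) \<in> conn G F" "(head G e, y) \<in> conn G F" for x y
    using that assms conn_sym by (meson rtrancl_trans)
  then show ?thesis
    unfolding conn_insert by (auto intro: conn_sym)
qed

lemma conn_isolated: "v \<notin> edge_verts G F \<Longrightarrow> (v, w) \<in> conn G F \<Longrightarrow> w = v"
  by (erule converse_rtranclE) (auto simp: edge_rel_def edge_verts_def)

lemma conn_edge_verts: "(v, w) \<in> conn G F \<Longrightarrow> v \<in> edge_verts G F \<Longrightarrow> w \<in> edge_verts G F"
  using conn_isolated conn_sym by metis

section \<open>Components as classes of the connectivity relation\<close>

lemma wf_edge_subgraph: "wf_digraph (edge_subgraph G F)"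
  by unfold_locales (auto simp: edge_subgraph_def edge_verts_def)

text \<open>All vertices of \<open>H\<close> are reached from \<open>u\<close> along edges of F.
  This gives the maximality of the subgraph induced by a class.\<close>

lemma connected_subgraph_in_class:
  assumes "Digraph_Component.connected H" "subgraph H (edge_subgraph G F)" "u \<in> verts H"
  shows "subgraph H (edge_subgraph G F \<restriction> (conn G F `` {u}))"
proof -
  interpret H: wf_digraph H using assms(2) by (simp add: subgraph_def)
  have "symcl (arcs_ends H) \<subseteq> edge_rel G F"
    using assms(2) by (auto simp: subgraph_def compatible_def edge_subgraph_def
        symcl_def arcs_ends_conv edge_rel_def)
  then have "(symcl (arcs_ends H))\<^sup>* \<subseteq> conn G F" by (rule rtrancl_mono)
  moreover have "(u, v) \<in> (symcl (arcs_ends H))\<^sup>*" if "v \<in> verts H" for v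
    using assms(1,3) that rtrancl_on_rtranclI unfolding connected_conv by metis
  ultimately have "verts H \<subseteq> conn G F `` {u}" by auto
  moreover have "tail H e \<in> verts H" "head H e \<in> verts H" if "e \<in> arcs H" for e
    using that by simp_all
  moreover have "wf_digraph (edge_subgraph G F \<restriction> (conn G F `` {u}))"
    by (rule wf_digraph.wellformed_induce_subgraph[OF wf_edge_subgraph])
  ultimately show ?thesis
    using assms(2) unfolding subgraph_def compatible_def by (simp add: subset_iff)
qed

text \<open>A path starting in the class of \<open>u\<close> never leaves it, so it is also a path
  in the induced subgraph.\<close>

lemma connected_class:
  assumes "u \<in> edge_verts G F"
  shows "Digraph_Component.connected (edge_subgraph G F \<restriction> (conn G F `` {u}))"
    (is "Digraph_Component.connected ?H")
proof -
  interpret H: wf_digraph ?H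
    by (rule wf_digraph.wellformed_induce_subgraph[OF wf_edge_subgraph])
  have "(x, y) \<in> rtrancl_on (verts ?H) (symcl (arcs_ends ?H))"
    if "(x, y) \<in> conn G F" "x \<in> verts ?H" for x y
    using that
  proof (induction rule: rtrancl_induct)
    case (step y z)
    have uy: "(u, y) \<in> conn G F" "(u, z) \<in> conn G F" using step by auto
    moreover have "(y, z) \<in> symcl (arcs_ends ?H)"
      using step(2) uy by (auto simp: edge_rel_def symcl_def arcs_ends_conv edge_subgraph_def)
    ultimately show ?case
      using step by (auto intro: rtrancl_on_into_rtrancl_on)
  qed simp
  moreover have "(x, y) \<in> conn G F" if "x \<in> verts ?H" "y \<in> verts ?H" for x y
    using that conn_sym[of u x G F] by (auto intro: rtrancl_trans)
  ultimately show ?thesis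
    unfolding connected_conv by auto
qed

text \<open>Inducing a subgraph is a bijection from the classes to the maximal connected subgraphs;
  it is injective because the vertex set gives the class back.\<close>

lemma num_components_eq: "num_components G F = card (edge_verts G F // conn G F)"
proof -
  let ?E = "edge_subgraph G F"
  interpret wf_digraph ?E by (rule wf_edge_subgraph)
  have sub: "subgraph (?E \<restriction> (conn G F `` {u})) ?E" if "u \<in> edge_verts G F" for u
    using that conn_edge_verts
    by (intro subgraph_induce_subgraphI) (fastforce simp: edge_subgraph_def)
  have "{H. max_subgraph Digraph_Component.connected H} =
    (\<lambda>K. ?E \<restriction> K) ` (edge_verts G F // conn G F)"
  proof (intro equalityI subsetI)
    fix H assume "H \<in> {H. max_subgraph Digraph_Component.connected H}"
    then have H: "subgraph H ?E" "Digraph_Component.connected H"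
      and max: "\<And>H'. subgraph H H' \<Longrightarrow> subgraph H' ?E \<Longrightarrow> Digraph_Component.connected H' \<Longrightarrow> H' = H"
      by (auto simp: max_subgraph_def)
    obtain u where u: "u \<in> verts H"
      using H(2) by (auto simp: Digraph_Component.connected_def strongly_connected_def)
    then have uF: "u \<in> edge_verts G F"
      using H(1) by (auto simp: subgraph_def edge_subgraph_def)
    \<comment> \<open>The subgraph induced by the class of \<open>u\<close> is connected and
      contains \<open>H\<close>, so maximality of \<open>H\<close> forces equality.\<close>
    have "H = ?E \<restriction> (conn G F `` {u})"
      using max[OF connected_subgraph_in_class[OF H(2,1) u] sub[OF uF] connected_class[OF uF]] ..
    then show "H \<in> (\<lambda>K. ?E \<restriction> K) ` (edge_verts G F // conn G F)"
      using uF by (simp add: quotientI)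
  next
    fix H assume "H \<in> (\<lambda>K. ?E \<restriction> K) ` (edge_verts G F // conn G F)"
    then obtain u where u: "u \<in> edge_verts G F" and H: "H = ?E \<restriction> (conn G F `` {u})"
      by (auto elim!: quotientE)
    have "max_subgraph Digraph_Component.connected H"
    proof (rule max_subgraphI)
      fix H' assume H': "H \<noteq> H'" "subgraph H H'" "subgraph H' ?E"
      show "\<not> Digraph_Component.connected H'"
      proof
        assume "Digraph_Component.connected H'"
        moreover have "u \<in> verts H'" using H'(2) H by (auto simp: subgraph_def)
        ultimately have "subgraph H' H"
          unfolding H using H'(3) by (intro connected_subgraph_in_class)
        then have "H = H'"
          using H'(2) by (intro pre_digraph.equality) (auto simp: subgraph_def compatible_def)
        then show False using H'(1) by simp
      qed
    qed (simp_all add: H u sub connected_class)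
    then show "H \<in> {H. max_subgraph Digraph_Component.connected H}" by simp
  qed
  moreover have "inj_on (\<lambda>K. ?E \<restriction> K) (edge_verts G F // conn G F)"
    by (rule inj_onI) (metis induce_subgraph_verts)
  ultimately show ?thesis
    unfolding num_components_def by (simp add: card_image)
qed

text \<open>Every vertex of V outside V(F) adds one vertex and one singleton class, which cancel in
  the difference.\<close>

lemma rank_eq:
  assumes "finite V" "edge_verts G F \<subseteq> V"
  shows "real (card (edge_verts G F)) - real (num_components G F)
    = real (card V) - real (card (V // conn G F))"
proof -
  let ?A = "edge_verts G F" and ?r = "conn G F"
  have "V // ?r = ?A // ?r \<union> (V - ?A) // ?r"
    using assms(2) by (auto simp: quotient_def)
  moreover have iso: "(V - ?A) // ?r = (\<lambda>v. {v}) ` (V - ?A)"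
    using conn_isolated[of _ G F] by (fastforce simp: quotient_def)
  moreover have "?A // ?r \<inter> (\<lambda>v. {v}) ` (V - ?A) = {}"
    by (auto elim!: quotientE dest!: equalityD1)
  moreover have fin: "finite ?A" using assms finite_subset by blast
  moreover have "finite (?A // ?r)" using fin by (simp add: quotient_def)
  ultimately have "card (V // ?r) = card (?A // ?r) + card (V - ?A)"
    using assms(1) by (simp add: card_Un_disjoint card_image)
  moreover have "card (V - ?A) + card ?A = card V"
    using assms fin by (simp add: card_Diff_subset card_mono)
  ultimately show ?thesis
    unfolding num_components_eq by simp
qed

section \<open>Gains\<close>

text \<open>The empty walk is allowed at every vertex, also outside \<open>V(F)\<close>; it only contributes the
  identity to the gain subgroup.\<close>

inductive gwalk :: "('g, 'm) monoid_scheme \<Rightarrow> ('v, 'e) pre_digraph \<Rightarrow> ('e \<Rightarrow> 'g) \<Rightarrow> 'e set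
    \<Rightarrow> 'v \<Rightarrow> 'v \<Rightarrow> 'g \<Rightarrow> bool"
  for \<Gamma> G \<psi> F where
  refl: "gwalk \<Gamma> G \<psi> F u u \<one>\<^bsub>\<Gamma>\<^esub>"
| forward: "e \<in> F \<Longrightarrow> gwalk \<Gamma> G \<psi> F (head G e) v x
    \<Longrightarrow> gwalk \<Gamma> G \<psi> F (tail G e) v (\<psi> e \<otimes>\<^bsub>\<Gamma>\<^esub> x)"
| backward: "e \<in> F \<Longrightarrow> gwalk \<Gamma> G \<psi> F (tail G e) v x
    \<Longrightarrow> gwalk \<Gamma> G \<psi> F (head G e) v (inv\<^bsub>\<Gamma>\<^esub> (\<psi> e) \<otimes>\<^bsub>\<Gamma>\<^esub> x)"

lemma gwalk_mono: "gwalk \<Gamma> G \<psi> X u v x \<Longrightarrow> X \<subseteq> Y \<Longrightarrow> gwalk \<Gamma> G \<psi> Y u v x"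
  by (induction rule: gwalk.induct) (auto intro: gwalk.intros)

text \<open>\<open>cas\<close> only checks that consecutive steps fit together; that the edges
  belong to F is therefore stated separately.\<close>

lemma cas_imp_gwalk:
  assumes "pre_digraph.cas (both_directions (edge_subgraph G F)) u p v" "set p \<subseteq> F \<times> UNIV"
  shows "gwalk \<Gamma> G \<psi> F u v (walk_gain \<Gamma> \<psi> p)"
  using assms
proof (induction p arbitrary: u)
  case Nil
  then show ?case by (simp add: pre_digraph.cas.simps gwalk.refl)
next
  case (Cons s p)
  then show ?case
    by (cases s; cases "snd s")
      (auto simp: pre_digraph.cas.simps both_directions_def edge_subgraph_def
        intro: gwalk.intros)
qed

lemma gwalk_imp_cas:
  assumes "gwalk \<Gamma> G \<psi> F u v x"
  shows "\<exists>p. pre_digraph.cas (both_directions (edge_subgraph G F)) u p v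
    \<and> set p \<subseteq> F \<times> UNIV \<and> walk_gain \<Gamma> \<psi> p = x"
  using assms
proof (induction rule: gwalk.induct)
  case (refl u)
  then show ?case by (auto intro!: exI[of _ "[]"] simp: pre_digraph.cas.simps)
next
  case (forward e v x)
  then obtain p where "pre_digraph.cas (both_directions (edge_subgraph G F)) (head G e) p v"
    "set p \<subseteq> F \<times> UNIV" "walk_gain \<Gamma> \<psi> p = x" by blast
  with forward(1) show ?case
    by (intro exI[of _ "(e, True) # p"])
      (simp add: pre_digraph.cas.simps both_directions_def edge_subgraph_def)
next
  case (backward e v x)
  then obtain p where "pre_digraph.cas (both_directions (edge_subgraph G F)) (tail G e) p v"
    "set p \<subseteq> F \<times> UNIV" "walk_gain \<Gamma> \<psi> p = x" by blast
  with backward(1) show ?case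
    by (intro exI[of _ "(e, False) # p"])
      (simp add: pre_digraph.cas.simps both_directions_def edge_subgraph_def)
qed

lemma (in group) generate_insert_one: "generate G (insert \<one> S) = generate G S"
proof
  show "generate G (insert \<one> S) \<subseteq> generate G S"
  proof
    fix x assume "x \<in> generate G (insert \<one> S)"
    then show "x \<in> generate G S"
      by induction (auto intro: generate.intros)
  qed
qed (auto intro: mono_generate[THEN subsetD])

text \<open>The two generating sets differ at most in the identity: an \<open>awalk\<close> must
  start in V(F), which every nonempty closed walk with edges in F does, while \<open>gwalk\<close>
  has an empty walk at every vertex.\<close>

lemma (in group) gain_subgroup_eq:
  "gain_subgroup G D \<psi> F = generate G {x. \<exists>u. gwalk G D \<psi> F u u x}"
proof -
  let ?B = "both_directions (edge_subgraph D F)"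
  let ?S = "{walk_gain G \<psi> p | u p. pre_digraph.awalk ?B u p u}"
  let ?T = "{x. \<exists>u. gwalk G D \<psi> F u u x}"
  have verts: "verts ?B = edge_verts D F" and arcs: "arcs ?B = F \<times> UNIV"
    by (simp_all add: both_directions_def edge_subgraph_def)
  have "?S \<subseteq> ?T"
    using cas_imp_gwalk by (fastforce simp: pre_digraph.awalk_def arcs)
  moreover have "?T \<subseteq> insert \<one> ?S"
  proof
    fix x assume "x \<in> ?T"
    then obtain u where "gwalk G D \<psi> F u u x" by blast
    from gwalk_imp_cas[OF this] obtain p where p: "pre_digraph.cas ?B u p u" "set p \<subseteq> F \<times> UNIV" "walk_gain G \<psi> p = x"
      by blast
    show "x \<in> insert \<one> ?S"
    proof (cases p)
      case Nil
      then show ?thesis using p(3) by simp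
    next
      case (Cons s q)
      then have "u = tail ?B s" "fst s \<in> F"
        using p by (auto simp: pre_digraph.cas.simps)
      then have "u \<in> edge_verts D F"
        by (cases s) (auto simp: both_directions_def edge_subgraph_def edge_verts_def)
      then show ?thesis
        using p by (auto simp: pre_digraph.awalk_def arcs verts)
    qed
  qed
  ultimately have "generate G ?S \<subseteq> generate G ?T" "generate G ?T \<subseteq> generate G ?S"
    using mono_generate[of ?S ?T] mono_generate[of ?T "insert \<one> ?S"]
    by (simp_all only: generate_insert_one)
  then show ?thesis
    unfolding gain_subgroup_def by simp
qed

section \<open>Walks, potentials and gain subgroups over an abelian group\<close>

locale abelian_gain_graph = gain_graph \<Gamma> G \<psi> + comm_group \<Gamma>
  for \<Gamma> :: "('g, 'm) monoid_scheme" (structure)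
    and G :: "('v, 'e) pre_digraph" and \<psi> :: "'e \<Rightarrow> 'g"
begin

abbreviation "walk \<equiv> gwalk \<Gamma> G \<psi>"

abbreviation "gains \<equiv> gain_subgroup \<Gamma> G \<psi>"

lemma inv_cancel [simp]:
  assumes "x \<in> carrier \<Gamma>" "y \<in> carrier \<Gamma>"
  shows "inv x \<otimes> (x \<otimes> y) = y" "x \<otimes> (inv x \<otimes> y) = y"
  using assms by (simp_all add: m_assoc[symmetric])

text \<open>Applied with \<open>c\<close> the inverse of \<open>a\<close>: commutativity moves the
  two together, where they cancel.\<close>

lemma mult_swap:
  assumes "x \<in> carrier \<Gamma>" "a \<in> carrier \<Gamma>" "y \<in> carrier \<Gamma>" "b \<in> carrier \<Gamma>" "c \<in> carrier \<Gamma>"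
  shows "x \<otimes> a \<otimes> y \<otimes> (b \<otimes> c) = x \<otimes> b \<otimes> y \<otimes> (a \<otimes> c)"
  using assms by (simp add: m_ac)

lemma walk_closed: "walk F u v x \<Longrightarrow> F \<subseteq> arcs G \<Longrightarrow> x \<in> carrier \<Gamma>"
  by (induction rule: gwalk.induct) (auto intro: gain_closed)

lemma walk_append:
  assumes "walk F u v x" "walk F v w y" "F \<subseteq> arcs G"
  shows "walk F u w (x \<otimes> y)"
  using assms
proof (induction rule: gwalk.induct)
  case (refl u)
  then show ?case using walk_closed by simp
next
  case (forward e v x)
  then have "\<psi> e \<in> carrier \<Gamma>" "x \<in> carrier \<Gamma>" "y \<in> carrier \<Gamma>"
    using gain_closed walk_closed by auto
  then show ?case
    using gwalk.forward[OF forward(1) forward(3)[OF forward(4,5)]] by (simp add: m_assoc)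
next
  case (backward e v x)
  then have "\<psi> e \<in> carrier \<Gamma>" "x \<in> carrier \<Gamma>" "y \<in> carrier \<Gamma>"
    using gain_closed walk_closed by auto
  then show ?case
    using gwalk.backward[OF backward(1) backward(3)[OF backward(4,5)]] by (simp add: m_assoc)
qed

lemma walk_edge:
  assumes "e \<in> F" "F \<subseteq> arcs G"
  shows "walk F (tail G e) (head G e) (\<psi> e)" "walk F (head G e) (tail G e) (inv (\<psi> e))"
proof -
  have "\<psi> e \<in> carrier \<Gamma>" using assms gain_closed by blast
  then show "walk F (tail G e) (head G e) (\<psi> e)" "walk F (head G e) (tail G e) (inv (\<psi> e))"
    using gwalk.forward[OF assms(1) gwalk.refl, of \<Gamma> G \<psi>]
      gwalk.backward[OF assms(1) gwalk.refl, of \<Gamma> G \<psi>] by simp_all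
qed

lemma walk_rev:
  assumes "walk F u v x" "F \<subseteq> arcs G"
  shows "walk F v u (inv x)"
  using assms
proof (induction rule: gwalk.induct)
  case (refl u)
  then show ?case by (simp add: gwalk.refl)
next
  case (forward e v x)
  then have c: "\<psi> e \<in> carrier \<Gamma>" "x \<in> carrier \<Gamma>" using gain_closed walk_closed by auto
  have "walk F v (tail G e) (inv x \<otimes> inv (\<psi> e))"
    by (rule walk_append[OF forward(3)[OF forward(4)] walk_edge(2)[OF forward(1,4)] forward(4)])
  then show ?case using c by (simp add: inv_mult_group)
next
  case (backward e v x)
  then have c: "\<psi> e \<in> carrier \<Gamma>" "x \<in> carrier \<Gamma>" using gain_closed walk_closed by auto
  have "walk F v (head G e) (inv x \<otimes> \<psi> e)"
    by (rule walk_append[OF backward(3)[OF backward(4)] walk_edge(1)[OF backward(1,4)] backward(4)])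
  then show ?case using c by (simp add: inv_mult_group)
qed

lemma conn_imp_walk:
  assumes "(u, v) \<in> conn G F" "F \<subseteq> arcs G"
  shows "\<exists>x. walk F u v x"
  using assms
proof (induction rule: rtrancl_induct)
  case base
  show ?case by (rule exI) (rule gwalk.refl)
next
  case (step v w)
  obtain e where e: "e \<in> F" "(v, w) = (tail G e, head G e) \<or> (v, w) = (head G e, tail G e)"
    using step(2) unfolding edge_rel_def by blast
  obtain y where "walk F v w y"
    using walk_edge[OF e(1) step.prems] e(2) by auto
  then show ?case using step.IH[OF step.prems] walk_append[OF _ _ step.prems] by blast
qed

lemma gains_eq: "gains F = generate \<Gamma> {x. \<exists>u. walk F u u x}"
  by (rule gain_subgroup_eq)

lemma subgroup_gains: "F \<subseteq> arcs G \<Longrightarrow> subgroup (gains F) \<Gamma>"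
  unfolding gains_eq using walk_closed by (intro generate_is_subgroup) auto

lemma walk_in_gains: "walk F u u x \<Longrightarrow> x \<in> gains F"
  unfolding gains_eq by (auto intro: generate.incl)

lemma gains_mono: "X \<subseteq> Y \<Longrightarrow> gains X \<subseteq> gains Y"
  unfolding gains_eq by (intro mono_generate) (auto intro: gwalk_mono)

text \<open>A potential that makes every edge gain trivial modulo \<open>K\<close> witnesses that all closed
  walks have gains in \<open>K\<close>; this replaces any decomposition of closed walks.\<close>

definition balanced :: "'g set \<Rightarrow> 'e set \<Rightarrow> ('v \<Rightarrow> 'g) \<Rightarrow> bool" where
  "balanced K F p \<longleftrightarrow> range p \<subseteq> carrier \<Gamma> \<and>
     (\<forall>e\<in>F. p (tail G e) \<otimes> \<psi> e \<otimes> inv (p (head G e)) \<in> K)"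

text \<open>The product telescopes: the potential at each inner vertex of the walk meets its
  inverse. An edge traversed backwards contributes the inverse of its element of
  \<open>K\<close>.\<close>

lemma balanced_walk:
  assumes "walk F u v x" and K: "subgroup K \<Gamma>" "balanced K F p" and F: "F \<subseteq> arcs G"
  shows "p u \<otimes> x \<otimes> inv (p v) \<in> K"
  using assms(1)
proof (induction rule: gwalk.induct)
  case (refl u)
  have "p u \<in> carrier \<Gamma>" using K(2) by (auto simp: balanced_def)
  then show ?case using subgroup.one_closed[OF K(1)] by simp
next
  case (forward e v x)
  have c: "p w \<in> carrier \<Gamma>" for w using K(2) by (auto simp: balanced_def)
  have c': "\<psi> e \<in> carrier \<Gamma>" "x \<in> carrier \<Gamma>"
    using forward gain_closed walk_closed F by auto
  have "p (tail G e) \<otimes> \<psi> e \<otimes> inv (p (head G e)) \<in> K"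
    using forward(1) K(2) by (simp add: balanced_def)
  then have "(p (tail G e) \<otimes> \<psi> e \<otimes> inv (p (head G e))) \<otimes> (p (head G e) \<otimes> x \<otimes> inv (p v)) \<in> K"
    using forward(3) by (rule subgroup.m_closed[OF K(1)])
  then show ?case using c c' by (simp add: m_assoc)
next
  case (backward e v x)
  have c: "p w \<in> carrier \<Gamma>" for w using K(2) by (auto simp: balanced_def)
  have c': "\<psi> e \<in> carrier \<Gamma>" "x \<in> carrier \<Gamma>"
    using backward gain_closed walk_closed F by auto
  have "inv (p (tail G e) \<otimes> \<psi> e \<otimes> inv (p (head G e))) \<in> K"
    using backward(1) K by (simp add: balanced_def subgroup.m_inv_closed)
  then have "inv (p (tail G e) \<otimes> \<psi> e \<otimes> inv (p (head G e))) \<otimes> (p (tail G e) \<otimes> x \<otimes> inv (p v)) \<in> K"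
    using backward(3) by (rule subgroup.m_closed[OF K(1)])
  then show ?case using c c' by (simp add: m_assoc inv_mult_group)
qed

lemma balanced_imp_gains_subset:
  assumes "subgroup K \<Gamma>" "balanced K F p" "F \<subseteq> arcs G"
  shows "gains F \<subseteq> K"
proof -
  have "x \<in> K" if "walk F u u x" for u x
  proof -
    have "p u \<in> carrier \<Gamma>" "x \<in> carrier \<Gamma>"
      using assms that walk_closed by (auto simp: balanced_def)
    \<comment> \<open>On a closed walk the potential only conjugates the gain, which has no effect
      in an abelian group.\<close>
    then have "p u \<otimes> x \<otimes> inv (p u) = x" by (simp add: m_ac)
    then show ?thesis using balanced_walk[OF that assms] by simp
  qed
  then show ?thesis
    unfolding gains_eq using assms(1) by (intro generate_subgroup_incl) auto
qed

text \<open>The potential of \<open>v\<close> is the gain of a chosen walk to \<open>v\<close> from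
  a root of its component.\<close>

lemma ex_balanced:
  assumes F: "F \<subseteq> arcs G"
  shows "\<exists>p. balanced (gains F) F p"
proof -
  \<comment> \<open>All vertices of a class get the same root, because the set of candidates depends
    on the class only.\<close>
  define base where "base v = (SOME w. (w, v) \<in> conn G F)" for v
  have base: "(base v, v) \<in> conn G F" for v
    unfolding base_def by (rule someI[of _ v]) simp
  have base_eq: "base u = base v" if "(u, v) \<in> conn G F" for u v
  proof -
    have "(w, u) \<in> conn G F \<longleftrightarrow> (w, v) \<in> conn G F" for w
      using that conn_sym[OF that] by (meson rtrancl_trans)
    then show ?thesis by (simp add: base_def)
  qed
  define p where "p v = (SOME x. walk F (base v) v x)" for v
  have p: "walk F (base v) v (p v)" for v
    unfolding p_def using conn_imp_walk[OF base F] by (rule someI_ex)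
  have "p (tail G e) \<otimes> \<psi> e \<otimes> inv (p (head G e)) \<in> gains F" if "e \<in> F" for e
  proof -
    have "(tail G e, head G e) \<in> conn G F"
      using that by (auto simp: edge_rel_def)
    then have "base (tail G e) = base (head G e)" by (rule base_eq)
    \<comment> \<open>From the root to the tail, along \<open>e\<close>, and from the head back to
      the same root is a closed walk.\<close>
    then show ?thesis
      using walk_append[OF walk_append[OF p walk_edge(1)[OF that F] F] walk_rev[OF p F] F]
        walk_in_gains by simp
  qed
  then show ?thesis
    using walk_closed[OF p F] by (auto simp: balanced_def)
qed

text \<open>A potential balanced on F modulo \<open>gains F\<close> also balances \<open>e\<close>
  modulo the enlarged subgroup. Conversely, \<open>e\<close> followed by the reversed walk of gain
  \<open>h\<close> is closed.\<close>

lemma gains_insert_connected: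
  assumes "walk F (tail G e) (head G e) h" and F: "F \<subseteq> arcs G" and e: "e \<in> arcs G"
  shows "gains (insert e F) = generate \<Gamma> (insert (\<psi> e \<otimes> inv h) (gains F))" (is "_ = ?K")
proof
  have F': "insert e F \<subseteq> arcs G" using F e by simp
  have h: "h \<in> carrier \<Gamma>" using walk_closed[OF assms(1) F] .
  have \<psi>: "\<psi> e \<in> carrier \<Gamma>" using e by (rule gain_closed)
  have sub: "insert (\<psi> e \<otimes> inv h) (gains F) \<subseteq> carrier \<Gamma>"
    using subgroup.subset[OF subgroup_gains[OF F]] h \<psi> by auto
  have K: "subgroup ?K \<Gamma>" using sub by (rule generate_is_subgroup)
  have gK: "gains F \<subseteq> ?K" by (auto intro: generate.incl)
  obtain p where p: "balanced (gains F) F p" using ex_balanced[OF F] by blast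
  have c: "p w \<in> carrier \<Gamma>" for w using p by (auto simp: balanced_def)
  have "p (tail G e) \<otimes> h \<otimes> inv (p (head G e)) \<in> ?K"
    using balanced_walk[OF assms(1) subgroup_gains[OF F] p F] gK by blast
  moreover have "\<psi> e \<otimes> inv h \<in> ?K" by (auto intro: generate.incl)
  \<comment> \<open>Multiplying by the new generator exchanges \<open>h\<close> for
    \<open>\<psi> e\<close>, which turns the element obtained from the walk into the one required
    for \<open>e\<close>.\<close>
  ultimately have "p (tail G e) \<otimes> h \<otimes> inv (p (head G e)) \<otimes> (\<psi> e \<otimes> inv h) \<in> ?K"
    by (rule subgroup.m_closed[OF K])
  also have "p (tail G e) \<otimes> h \<otimes> inv (p (head G e)) \<otimes> (\<psi> e \<otimes> inv h)
      = p (tail G e) \<otimes> \<psi> e \<otimes> inv (p (head G e)) \<otimes> (h \<otimes> inv h)"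
    using c h \<psi> by (intro mult_swap) simp_all
  also have "\<dots> = p (tail G e) \<otimes> \<psi> e \<otimes> inv (p (head G e))"
    using c h \<psi> by simp
  finally have "balanced ?K (insert e F) p"
    using p gK by (auto simp: balanced_def)
  then show "gains (insert e F) \<subseteq> ?K"
    by (rule balanced_imp_gains_subset[OF K _ F'])
  have "walk (insert e F) (tail G e) (tail G e) (\<psi> e \<otimes> inv h)"
    by (rule walk_append[OF walk_edge(1)[OF insertI1 F']
          walk_rev[OF gwalk_mono[OF assms(1) subset_insertI] F'] F'])
  then have "\<psi> e \<otimes> inv h \<in> gains (insert e F)" by (rule walk_in_gains)
  then show "?K \<subseteq> gains (insert e F)"
    using gains_mono[of F "insert e F"] subgroup_gains[OF F']
    by (intro generate_subgroup_incl) auto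
qed

text \<open>Shifting a potential by a constant on one component keeps it balanced on F. As the ends
  of \<open>e\<close> lie in different components, such a shift can make \<open>e\<close> balanced
  too.\<close>

lemma gains_insert_disconnected:
  assumes ab: "(tail G e, head G e) \<notin> conn G F" and F: "F \<subseteq> arcs G" and e: "e \<in> arcs G"
  shows "gains (insert e F) = gains F"
proof
  have F': "insert e F \<subseteq> arcs G" using F e by simp
  have \<psi>: "\<psi> f \<in> carrier \<Gamma>" if "f \<in> insert e F" for f using that F' gain_closed by blast
  obtain p where p: "balanced (gains F) F p" using ex_balanced[OF F] by blast
  have c: "p w \<in> carrier \<Gamma>" for w using p by (auto simp: balanced_def)
  \<comment> \<open>Chosen so that
    \<open>p (head G e) \<otimes> k = p (tail G e) \<otimes> \<psi> e\<close>, which makes the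
    element belonging to \<open>e\<close> the identity.\<close>
  define k where "k = inv (p (head G e)) \<otimes> (p (tail G e) \<otimes> \<psi> e)"
  have k: "k \<in> carrier \<Gamma>" using c \<psi> by (simp add: k_def)
  define q where "q v = (if (head G e, v) \<in> conn G F then p v \<otimes> k else p v)" for v
  have "q (tail G f) \<otimes> \<psi> f \<otimes> inv (q (head G f)) \<in> gains F" if f: "f \<in> insert e F" for f
  proof (cases "f = e")
    case True
    have "q (tail G e) = p (tail G e)" using ab conn_sym[of "head G e" "tail G e"] by (auto simp: q_def)
    moreover have "q (head G e) = p (tail G e) \<otimes> \<psi> e"
      using c \<psi> by (simp add: q_def k_def)
    ultimately show ?thesis
      using True c \<psi> subgroup.one_closed[OF subgroup_gains[OF F]] by simp
  next
    case False
    then have "f \<in> F" using f by simp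
    then have "(tail G f, head G f) \<in> conn G F" by (auto simp: edge_rel_def)
    \<comment> \<open>Both ends of an old edge are shifted or neither is; if both are,
      \<open>k\<close> cancels.\<close>
    then have same: "(head G e, tail G f) \<in> conn G F \<longleftrightarrow> (head G e, head G f) \<in> conn G F"
      using conn_sym by (meson rtrancl_trans)
    have "p (tail G f) \<otimes> k \<otimes> \<psi> f \<otimes> inv (p (head G f) \<otimes> k)
        = p (tail G f) \<otimes> inv (p (head G f)) \<otimes> \<psi> f \<otimes> (k \<otimes> inv k)"
      unfolding inv_mult[OF c k] using c k \<psi>[OF f] by (intro mult_swap) simp_all
    also have "\<dots> = p (tail G f) \<otimes> \<psi> f \<otimes> inv (p (head G f))"
      using c k \<psi>[OF f] by (simp add: m_ac)
    finally have "q (tail G f) \<otimes> \<psi> f \<otimes> inv (q (head G f))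
        = p (tail G f) \<otimes> \<psi> f \<otimes> inv (p (head G f))"
      using same by (simp add: q_def)
    then show ?thesis using p \<open>f \<in> F\<close> by (simp add: balanced_def)
  qed
  then have "balanced (gains F) (insert e F) q"
    using c k by (auto simp: balanced_def q_def)
  then show "gains (insert e F) \<subseteq> gains F"
    by (rule balanced_imp_gains_subset[OF subgroup_gains[OF F] _ F'])
qed (simp add: gains_mono subset_insertI)

end

section \<open>Increments of \<open>ell\<close>\<close>

context abelian_gain_graph
begin

context
  fixes \<mu> :: "'g set \<Rightarrow> real"
  assumes \<mu>: "symmetric_polymatroidal \<Gamma> \<mu>"
    and \<mu>_le_one: "\<And>\<gamma>. \<gamma> \<in> carrier \<Gamma> \<Longrightarrow> \<mu> {\<gamma>} \<le> 1"
begin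

text \<open>With the vertex set fixed, only the number of classes and the last term depend on
  F.\<close>

lemma ell_eq:
  assumes "F \<subseteq> arcs G"
  shows "ell \<Gamma> G \<psi> \<mu> F =
    real (card (verts G)) - real (card (verts G // conn G F)) + \<mu> (gains F)"
proof -
  have "edge_verts G F \<subseteq> verts G"
    using assms by (auto simp: edge_verts_def)
  then show ?thesis
    unfolding ell_def by (simp add: rank_eq[OF finite_verts])
qed

lemma ell_insert_disconnected:
  assumes "(tail G e, head G e) \<notin> conn G F" "F \<subseteq> arcs G" "e \<in> arcs G"
  shows "ell \<Gamma> G \<psi> \<mu> (insert e F) - ell \<Gamma> G \<psi> \<mu> F = 1"
proof -
  have "card (verts G // conn G F) = Suc (card (verts G // conn G (insert e F)))"
    by (rule card_quotient_merge[OF finite_verts _ _ _ _ _ assms(1) conn_insert])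
      (use assms(3) in \<open>simp_all add: refl_rtrancl trans_rtrancl sym_conn\<close>)
  then show ?thesis
    using assms by (simp add: ell_eq gains_insert_disconnected)
qed

lemma ell_insert_connected:
  assumes "walk F (tail G e) (head G e) h" "(tail G e, head G e) \<in> conn G F"
    and F: "F \<subseteq> arcs G" and e: "e \<in> arcs G"
  shows "ell \<Gamma> G \<psi> \<mu> (insert e F) - ell \<Gamma> G \<psi> \<mu> F
    = \<mu> (insert (\<psi> e \<otimes> inv h) (gains F)) - \<mu> (gains F)"
proof -
  have "insert (\<psi> e \<otimes> inv h) (gains F) \<subseteq> carrier \<Gamma>"
    using subgroup.subset[OF subgroup_gains[OF F]] walk_closed[OF assms(1) F] gain_closed[OF e]
    by auto
  moreover have "\<forall>X \<subseteq> carrier \<Gamma>. X \<noteq> {} \<longrightarrow> \<mu> X = \<mu> (generate \<Gamma> X)"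
    using \<mu> unfolding symmetric_polymatroidal_def by blast
  \<comment> \<open>Invariance of \<open>\<mu>\<close> under generation replaces the enlarged
    subgroup by a one-element insertion, to which submodularity applies directly.\<close>
  ultimately have "\<mu> (insert (\<psi> e \<otimes> inv h) (gains F)) = \<mu> (gains (insert e F))"
    unfolding gains_insert_connected[OF assms(1) F e] by blast
  then show ?thesis
    using F e by (simp add: ell_eq conn_insert_connected[OF assms(2)])
qed

lemma ell_increments:
  assumes "X \<subseteq> Y" and Y: "Y \<subseteq> arcs G" and e: "e \<in> arcs G"
  shows "ell \<Gamma> G \<psi> \<mu> (insert e Y) - ell \<Gamma> G \<psi> \<mu> Y
    \<le> ell \<Gamma> G \<psi> \<mu> (insert e X) - ell \<Gamma> G \<psi> \<mu> X"
proof -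
  have X: "X \<subseteq> arcs G" using assms by blast
  have sub: "submodular_on (carrier \<Gamma>) \<mu>" and mono: "mono_on (Pow (carrier \<Gamma>)) \<mu>"
    and nonneg: "\<And>Z. Z \<subseteq> carrier \<Gamma> \<Longrightarrow> 0 \<le> \<mu> Z"
    using \<mu> by (auto simp: symmetric_polymatroidal_def)
  have HY: "gains Y \<subseteq> carrier \<Gamma>" by (rule subgroup.subset[OF subgroup_gains[OF Y]])
  show ?thesis
  proof (cases "(tail G e, head G e) \<in> conn G Y")
    case False
    then have "(tail G e, head G e) \<notin> conn G X" using conn_mono[OF assms(1)] by blast
    then show ?thesis
      using False X Y e by (simp add: ell_insert_disconnected)
  next
    case conn_Y: True
    show ?thesis
    proof (cases "(tail G e, head G e) \<in> conn G X")
      case True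
      then obtain h where h: "walk X (tail G e) (head G e) h"
        using conn_imp_walk X by blast
      then have "\<psi> e \<otimes> inv h \<in> carrier \<Gamma>" using walk_closed X gain_closed[OF e] by simp
      \<comment> \<open>The walk in \<open>X\<close> is also a walk in \<open>Y\<close>, so both
        increments come from inserting the same element into nested subgroups.\<close>
      from submodular_insert_diminishing[OF sub mono gains_mono[OF assms(1)] HY this]
      show ?thesis
        using ell_insert_connected[OF h True X e]
          ell_insert_connected[OF gwalk_mono[OF h assms(1)] conn_Y Y e] by simp
    next
      case False
      obtain h where h: "walk Y (tail G e) (head G e) h"
        using conn_imp_walk conn_Y Y by blast
      then have "\<psi> e \<otimes> inv h \<in> carrier \<Gamma>" using walk_closed Y gain_closed[OF e] by simp
      \<comment> \<open>Here the increment at \<open>X\<close> equals 1, and the one at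
        \<open>Y\<close> is at most the value of \<open>\<mu>\<close> on a singleton.\<close>
      from submodular_insert_le[OF sub nonneg HY this] \<mu>_le_one[OF this]
      show ?thesis
        using ell_insert_connected[OF h conn_Y Y e] ell_insert_disconnected[OF False X e] by simp
    qed
  qed
qed

lemma ell_insert_mono:
  assumes F: "F \<subseteq> arcs G" and e: "e \<in> arcs G"
  shows "ell \<Gamma> G \<psi> \<mu> F \<le> ell \<Gamma> G \<psi> \<mu> (insert e F)"
proof (cases "(tail G e, head G e) \<in> conn G F")
  case True
  then obtain h where h: "walk F (tail G e) (head G e) h"
    using conn_imp_walk F by blast
  have "insert (\<psi> e \<otimes> inv h) (gains F) \<subseteq> carrier \<Gamma>"
    using subgroup.subset[OF subgroup_gains[OF F]] walk_closed[OF h F] gain_closed[OF e] by auto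
  moreover have "mono_on (Pow (carrier \<Gamma>)) \<mu>"
    using \<mu> unfolding symmetric_polymatroidal_def by blast
  ultimately have "\<mu> (gains F) \<le> \<mu> (insert (\<psi> e \<otimes> inv h) (gains F))"
    by (intro mono_onD[of _ \<mu>]) auto
  then show ?thesis using ell_insert_connected[OF h True F e] by simp
next
  case False
  then show ?thesis using ell_insert_disconnected[OF False F e] by simp
qed

end

end

theorem theorem8p1:
  fixes \<Gamma> :: "('g, 'm) monoid_scheme"
    and G :: "('v, 'e) pre_digraph"
    and \<psi> :: "'e \<Rightarrow> 'g"
    and \<mu> :: "'g set \<Rightarrow> real"
  assumes "comm_group \<Gamma>"
    and "gain_graph \<Gamma> G \<psi>"
    and "symmetric_polymatroidal \<Gamma> \<mu>"
    and "\<And>\<gamma>. \<gamma> \<in> carrier \<Gamma> \<Longrightarrow> \<mu> {\<gamma>} \<le> 1"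
  shows "mono_on (Pow (arcs G)) (ell \<Gamma> G \<psi> \<mu>) \<and> submodular_on (arcs G) (ell \<Gamma> G \<psi> \<mu>)"
proof -
  interpret abelian_gain_graph \<Gamma> G \<psi>
    using assms(1,2) by (simp add: abelian_gain_graph_def)
  show ?thesis
    using ell_insert_mono[OF assms(3,4)] ell_increments[OF assms(3,4)]
    by (intro mono_submodular_by_increments finite_arcs)
qed

end
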